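(* Let $E$ be a Banach lattice and let $F$ be an order continuous Banach lattice. Then every $L$-weakly compact, $uaw$-continuous operator $T\colon E\to F$ is $uaw$-Dunford-Pettis.
   Context: A net $(x_\alpha)$ in a Banach lattice $G$ is $uaw$-convergent to $x$ if $|x_\alpha-x|\wedge u\to 0$ weakly for every $u\in G_+$. A bounded operator $T\colon E\to F$ between Banach lattices is $uaw$-continuous if it maps norm bounded $uaw$-null sequences in $E$ to $uaw$-null sequences in $F$; it is $uaw$-Dunford-Pettis if every norm bounded $uaw$-null sequence $(x_n)$ in $E$ satisfies $\|Tx_n\|\to 0$; it is $L$-weakly compact if every disjoint sequence contained in the solid hull of $T(B_E)$ is norm null. *)

theory Defs
  imports "HOL-Analysis.Analysis"
begin

class banach_lattice = banach + lattice +
  assumes bl_add_mono: "x \<le> y \<Longrightarrow> x + z \<le> y + z"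
    and bl_scale_mono: "x \<le> y \<Longrightarrow> 0 \<le> c \<Longrightarrow> c *\<^sub>R x \<le> c *\<^sub>R y"
    and bl_norm_mono: "sup x (- x) \<le> sup y (- y) \<Longrightarrow> norm x \<le> norm y"

definition lmod :: "'a::banach_lattice \<Rightarrow> 'a" where
  "lmod x = sup x (- x)"

text \<open>Order continuity of the norm: every downward directed set with infimum 0
(i.e. a decreasing net x_\<alpha> \<down> 0) is norm null.\<close>
definition order_continuous_norm :: "'a::banach_lattice itself \<Rightarrow> bool" where
  "order_continuous_norm _ \<longleftrightarrow>
     (\<forall>D::'a set. D \<noteq> {} \<and> (\<forall>x\<in>D. \<forall>y\<in>D. \<exists>z\<in>D. z \<le> x \<and> z \<le> y)
        \<and> (\<forall>x\<in>D. 0 \<le> x) \<and> (\<forall>w. (\<forall>x\<in>D. w \<le> x) \<longrightarrow> w \<le> 0)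
        \<longrightarrow> (\<forall>e>0. \<exists>x\<in>D. norm x < e))"

definition weakly_null :: "(nat \<Rightarrow> 'a::real_normed_vector) \<Rightarrow> bool" where
  "weakly_null x \<longleftrightarrow> (\<forall>f::'a \<Rightarrow> real. bounded_linear f \<longrightarrow> (\<lambda>n. f (x n)) \<longlonglongrightarrow> 0)"

definition uaw_null :: "(nat \<Rightarrow> 'a::banach_lattice) \<Rightarrow> bool" where
  "uaw_null x \<longleftrightarrow> (\<forall>u. 0 \<le> u \<longrightarrow> weakly_null (\<lambda>n. inf (lmod (x n)) u))"

definition norm_bounded_seq :: "(nat \<Rightarrow> 'a::real_normed_vector) \<Rightarrow> bool" where
  "norm_bounded_seq x \<longleftrightarrow> (\<exists>M. \<forall>n. norm (x n) \<le> M)"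

definition uaw_continuous :: "('a::banach_lattice \<Rightarrow> 'b::banach_lattice) \<Rightarrow> bool" where
  "uaw_continuous T \<longleftrightarrow> bounded_linear T \<and>
     (\<forall>x. norm_bounded_seq x \<and> uaw_null x \<longrightarrow> uaw_null (\<lambda>n. T (x n)))"

definition uaw_dunford_pettis :: "('a::banach_lattice \<Rightarrow> 'b::banach_lattice) \<Rightarrow> bool" where
  "uaw_dunford_pettis T \<longleftrightarrow> bounded_linear T \<and>
     (\<forall>x. norm_bounded_seq x \<and> uaw_null x \<longrightarrow> (\<lambda>n. norm (T (x n))) \<longlonglongrightarrow> 0)"

definition solid_hull :: "'a::banach_lattice set \<Rightarrow> 'a set" where
  "solid_hull A = {y. \<exists>a\<in>A. lmod y \<le> lmod a}"

definition disjoint_seq :: "(nat \<Rightarrow> 'a::banach_lattice) \<Rightarrow> bool" where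
  "disjoint_seq y \<longleftrightarrow> (\<forall>m n. m \<noteq> n \<longrightarrow> inf (lmod (y m)) (lmod (y n)) = 0)"

definition L_weakly_compact :: "('a::banach_lattice \<Rightarrow> 'b::banach_lattice) \<Rightarrow> bool" where
  "L_weakly_compact T \<longleftrightarrow> bounded_linear T \<and>
     (\<forall>y. disjoint_seq y \<and> (\<forall>n. y n \<in> solid_hull (T ` cball 0 1)) \<longrightarrow> y \<longlonglongrightarrow> 0)"

end

theory Submission
  imports Defs "HOL-Library.Lattice_Algebras"
begin

text \<open>By disjointification, L-weak compactness gives, for every e, an element u of the
  positive cone with \<open>norm (pprt (lmod (T x) - u)) \<le> e\<close> for all x in a given ball. Since
  \<open>lmod (T x) = pprt (lmod (T x) - u) + inf (lmod (T x)) u\<close>, it remains to see that the sequence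
  \<open>inf (lmod (T (x n))) u\<close>, which is weakly null by uaw-continuity, is norm null; this holds for
  weakly null sequences in order intervals of a Banach lattice with order continuous norm.\<close>

subsection \<open>Banach lattices\<close>

\<comment> \<open>Translation invariance of the order is the only axiom to check; in exchange
  \<open>pprt\<close>, \<open>nprt\<close> and their calculus apply to Banach lattices.\<close>
subclass (in banach_lattice) lattice_ab_group_add
  by standard (metis bl_add_mono add.commute)

instance banach_lattice \<subseteq> ordered_real_vector
proof
  fix a b :: real and x y :: 'a
  show "a *\<^sub>R x \<le> a *\<^sub>R y" if "x \<le> y" "0 \<le> a"
    using that by (rule bl_scale_mono)
  show "a *\<^sub>R x \<le> b *\<^sub>R x" if "a \<le> b" "0 \<le> x"
    using bl_add_mono[OF bl_scale_mono[OF that(2), of "b - a"], of "a *\<^sub>R x"] that(1)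
    by (simp add: scaleR_left_diff_distrib)
qed

lemma lmod_nonneg [simp]: "0 \<le> lmod (x :: 'a::banach_lattice)"
proof -
  have "x + - x \<le> lmod x + lmod x"
    unfolding lmod_def by (intro add_mono) simp_all
  then show ?thesis by simp
qed

lemma lmod_of_nonneg: "0 \<le> x \<Longrightarrow> lmod x = (x :: 'a::banach_lattice)"
  unfolding lmod_def by (rule sup_absorb1) (metis minus_le_self_iff)

text \<open>\<open>bl_norm_mono\<close> compares norms through moduli, and the modulus is
  idempotent, so it applies in both directions.\<close>

lemma norm_lmod [simp]: "norm (lmod x) = norm (x :: 'a::banach_lattice)"
proof -
  have "sup (lmod x) (- lmod x) = sup x (- x)"
    using lmod_of_nonneg[OF lmod_nonneg, of x] by (simp add: lmod_def)
  then show ?thesis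
    by (intro antisym bl_norm_mono) simp_all
qed

lemma norm_mono_lattice: "0 \<le> x \<Longrightarrow> x \<le> y \<Longrightarrow> norm x \<le> norm (y :: 'a::banach_lattice)"
  using lmod_of_nonneg[of x] lmod_of_nonneg[of y]
  by (intro bl_norm_mono) (simp add: lmod_def)

lemma norm_pprt_le: "norm (pprt x) \<le> norm (x :: 'a::banach_lattice)"
proof -
  have "pprt x \<le> lmod x"
    using lmod_nonneg[of x] by (simp add: pprt_def lmod_def)
  then show ?thesis
    using norm_mono_lattice[of "pprt x" "lmod x"] by simp
qed

lemma le_pprt: "x \<le> pprt (x :: 'a::banach_lattice)"
  by (simp add: pprt_def)

lemma pprt_le_iff: "pprt x \<le> y \<longleftrightarrow> x \<le> y \<and> 0 \<le> (y :: 'a::banach_lattice)"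
  by (simp add: pprt_def)

lemma pprt_add_le: "pprt (x + y) \<le> pprt x + pprt (y :: 'a::banach_lattice)"
  by (simp add: pprt_le_iff add_mono le_pprt)

lemma pprt_scaleR_le: "0 \<le> c \<Longrightarrow> pprt (c *\<^sub>R x) \<le> c *\<^sub>R pprt (x :: 'a::banach_lattice)"
  by (simp add: pprt_le_iff le_pprt scaleR_left_mono scaleR_nonneg_nonneg)

lemma lmod_scaleR_le: "0 \<le> c \<Longrightarrow> lmod (c *\<^sub>R x) \<le> c *\<^sub>R lmod (x :: 'a::banach_lattice)"
  by (simp add: lmod_def scaleR_left_mono flip: scaleR_minus_right)

text \<open>Taking \<open>pprt (- x)\<close> out of both arguments leaves \<open>inf x 0\<close>,
  which is exactly \<open>- pprt (- x)\<close>.\<close>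

lemma inf_pprt_pprt_minus: "inf (pprt x) (pprt (- x)) = (0 :: 'a::banach_lattice)"
proof -
  have "pprt x = x + pprt (- x)"
    by (metis add_diff_cancel_right' diff_conv_add_uminus pprt_neg prts)
  then have "inf (pprt x) (pprt (- x)) = inf x 0 + pprt (- x)"
    by (metis add_0 add_inf_distrib_right)
  then show ?thesis
    by (simp only: pprt_neg nprt_def right_minus)
qed

section \<open>Norm limits and the order\<close>

text \<open>The positive cone is closed: from \<open>0 \<le> x n\<close> follows
  \<open>- l \<le> x n - l\<close>, so the positive part of \<open>- l\<close> has norm at most that
  of \<open>x n - l\<close>, which tends to 0.\<close>

lemma nonneg_limit:
  fixes x :: "nat \<Rightarrow> 'a::banach_lattice"
  assumes "x \<longlonglongrightarrow> l" "\<And>n. 0 \<le> x n"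
  shows "0 \<le> l"
proof -
  have "norm (pprt (- l)) \<le> norm (x n - l)" for n
  proof -
    have "pprt (- l) \<le> pprt (x n - l)"
      using assms(2)[of n] by (intro pprt_mono) simp
    then have "norm (pprt (- l)) \<le> norm (pprt (x n - l))"
      by (intro norm_mono_lattice) simp_all
    then show ?thesis
      using norm_pprt_le[of "x n - l"] by simp
  qed
  moreover have "(\<lambda>n. norm (x n - l)) \<longlonglongrightarrow> 0"
    using assms(1) by (simp add: LIM_zero tendsto_norm_zero)
  ultimately have "norm (pprt (- l)) \<le> 0"
    by (meson LIMSEQ_le_const)
  then show ?thesis
    using le_pprt[of "- l"] by simp
qed

lemma limit_le:
  fixes x :: "nat \<Rightarrow> 'a::banach_lattice"
  assumes "x \<longlonglongrightarrow> l" "\<And>n. x n \<le> b"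
  shows "l \<le> b"
  using nonneg_limit[OF tendsto_diff[OF tendsto_const[of b] assms(1)]] assms(2) by simp

lemma le_limit:
  fixes x :: "nat \<Rightarrow> 'a::banach_lattice"
  assumes "x \<longlonglongrightarrow> l" "\<And>n. b \<le> x n"
  shows "b \<le> l"
  using nonneg_limit[OF tendsto_diff[OF assms(1) tendsto_const[of b]]] assms(2) by simp

lemma incseq_le_limit:
  fixes x :: "nat \<Rightarrow> 'a::banach_lattice"
  assumes "x \<longlonglongrightarrow> l" "incseq x"
  shows "x n \<le> l"
  by (rule le_limit[OF LIMSEQ_ignore_initial_segment[OF assms(1), of n]])
    (simp add: incseqD[OF assms(2)])

text \<open>Dividing by k bounds \<open>w\<close> by a null sequence, and the cone is
  closed.\<close>

lemma archimedean_lattice: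
  fixes w :: "'a::banach_lattice"
  assumes "\<And>k::nat. real k *\<^sub>R w \<le> c"
  shows "w \<le> 0"
proof -
  have "w \<le> inverse (real (Suc k)) *\<^sub>R c" for k
    using scaleR_left_mono[OF assms[of "Suc k"], of "inverse (real (Suc k))"] by simp
  moreover have "(\<lambda>k. inverse (real (Suc k)) *\<^sub>R c) \<longlonglongrightarrow> 0 *\<^sub>R c"
    by (intro tendsto_intros LIMSEQ_inverse_real_of_nat)
  ultimately show ?thesis
    using le_limit[of _ "0 *\<^sub>R c" w] by simp
qed

text \<open>Order continuity speaks of infima equal to 0, whereas \<open>x\<close> has no supremum
  given in advance. The set of all gaps between upper bounds and terms avoids naming one.\<close>

lemma incseq_convergent_order_continuous:
  fixes x :: "nat \<Rightarrow> 'a::banach_lattice"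
  assumes oc: "order_continuous_norm TYPE('a)" and inc: "incseq x" and bdd: "\<And>n. x n \<le> c"
  shows "convergent x"
proof -
  \<comment> \<open>The gaps between upper bounds and terms decrease to 0: a lower bound w of all
    of them can be subtracted from an upper bound arbitrarily often.\<close>
  define D where "D = {b - x n |b n. \<forall>m. x m \<le> b}"
  have dir: "\<exists>z\<in>D. z \<le> p \<and> z \<le> q" if pq: "p \<in> D" "q \<in> D" for p q
  proof -
    obtain b n b' n' where *: "p = b - x n" "\<forall>m. x m \<le> b" "q = b' - x n'" "\<forall>m. x m \<le> b'"
      using pq unfolding D_def by blast
    have "inf b b' - x (max n n') \<le> p" "inf b b' - x (max n n') \<le> q"
      unfolding * by (intro diff_mono inf_le1 inf_le2 incseqD[OF inc]; simp)+
    moreover have "\<forall>m. x m \<le> inf b b'" using * by simp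
    then have "inf b b' - x (max n n') \<in> D" unfolding D_def by blast
    ultimately show ?thesis by blast
  qed
  have low: "w \<le> 0" if w: "\<forall>d\<in>D. w \<le> d" for w
  proof -
    have "\<forall>m. x m \<le> c - real k *\<^sub>R w" for k
    proof (induction k)
      case (Suc k)
      show ?case
      proof
        fix m
        have "w \<le> (c - real k *\<^sub>R w) - x m"
          using w Suc unfolding D_def by blast
        then show "x m \<le> c - real (Suc k) *\<^sub>R w"
          by (simp add: le_diff_eq scaleR_left_distrib ac_simps)
      qed
    qed (simp add: bdd)
    then have "x 0 \<le> c - real k *\<^sub>R w" for k by blast
    then have "real k *\<^sub>R w \<le> c - x 0" for k
      by (simp add: le_diff_eq add.commute)
    then show ?thesis by (rule archimedean_lattice)
  qed
  have "D \<noteq> {}" using bdd unfolding D_def by blast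
  moreover have "\<forall>d\<in>D. 0 \<le> d" unfolding D_def by auto
  ultimately have small: "\<forall>e>0. \<exists>d\<in>D. norm d < e"
    using oc[unfolded order_continuous_norm_def, rule_format, of D] dir low by auto
  have "Cauchy x"
  proof (rule CauchyI')
    fix e :: real assume "0 < e"
    then obtain d where "d \<in> D" "norm d < e / 2"
      using small half_gt_zero by blast
    then obtain b n where b: "\<forall>m. x m \<le> b" "norm (b - x n) < e / 2"
      unfolding D_def by blast
    \<comment> \<open>Later gaps lie between 0 and the gap at \<open>n\<close>, so one small element
      of \<open>D\<close> controls the whole tail.\<close>
    have close: "norm (b - x m) < e / 2" if "m \<ge> n" for m
    proof -
      have "norm (b - x m) \<le> norm (b - x n)"
        using b(1) inc that by (intro norm_mono_lattice) (simp_all add: incseq_def)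
      then show ?thesis using b(2) by simp
    qed
    have "dist (x m) (x k) < e" if "m \<ge> n" "k > m" for m k
    proof -
      have "dist (x m) (x k) = norm ((b - x k) - (b - x m))"
        by (simp add: dist_norm)
      also have "\<dots> \<le> norm (b - x k) + norm (b - x m)"
        by (rule norm_triangle_ineq4)
      also have "\<dots> < e" using close[of m] close[of k] that by simp
      finally show ?thesis .
    qed
    then show "\<exists>M. \<forall>m\<ge>M. \<forall>k>m. dist (x m) (x k) < e" by blast
  qed
  then show ?thesis by (rule Cauchy_convergent)
qed

subsection \<open>Norming positive functionals\<close>

definition sublinear :: "('a::real_vector \<Rightarrow> real) \<Rightarrow> bool" where
  "sublinear p \<longleftrightarrow> (\<forall>x y. p (x + y) \<le> p x + p y) \<and> (\<forall>c\<ge>0. \<forall>x. p (c *\<^sub>R x) = c * p x)"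

lemma sublinear_add: "sublinear p \<Longrightarrow> p (x + y) \<le> p x + p y"
  and sublinear_scale: "sublinear p \<Longrightarrow> 0 \<le> c \<Longrightarrow> p (c *\<^sub>R x) = c * p x"
  by (simp_all add: sublinear_def)

lemma sublinear_zero: "sublinear p \<Longrightarrow> p 0 = 0"
  using sublinear_scale[of p 0 0] by simp

text \<open>Applying the inequality to \<open>inverse c\<close> and \<open>c *\<^sub>R x\<close>
  yields its converse, so one direction of homogeneity suffices for positive factors.\<close>

lemma sublinearI:
  fixes p :: "'a::real_vector \<Rightarrow> real"
  assumes add: "\<And>x y. p (x + y) \<le> p x + p y"
    and scale: "\<And>c x. 0 < c \<Longrightarrow> p (c *\<^sub>R x) \<le> c * p x"
    and zero: "p 0 = 0"
  shows "sublinear p"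
proof -
  have "p (c *\<^sub>R x) = c * p x" if "0 \<le> c" for c x
  proof (cases "c = 0")
    case False
    with that have c: "0 < c" by simp
    have "p (inverse c *\<^sub>R (c *\<^sub>R x)) \<le> inverse c * p (c *\<^sub>R x)"
      using c by (intro scale) simp
    then have "c * p x \<le> p (c *\<^sub>R x)"
      using c by (simp add: field_simps)
    then show ?thesis using scale[OF c, of x] by simp
  qed (simp add: zero)
  then show ?thesis using add by (simp add: sublinear_def)
qed

text \<open>Take \<open>q x\<close> as the infimum of \<open>p (x + t *\<^sub>R a) - t * p a\<close>
  over all t >= 0. The choice t = 0 gives \<open>q \<le> p\<close>; t = 1 at \<open>- a\<close>
  gives the last bound.\<close>

lemma sublinear_tilt:
  fixes p :: "'a::real_vector \<Rightarrow> real"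
  assumes p: "sublinear p"
  shows "\<exists>q. sublinear q \<and> q \<le> p \<and> q (- a) \<le> - p a"
proof -
  define h where "h x t = p (x + t *\<^sub>R a) - t * p a" for x t
  define q where "q x = (INF t\<in>{0..}. h x t)" for x
  \<comment> \<open>Subadditivity bounds the family below independently of \<open>t\<close>, which
    makes the real infimum meaningful.\<close>
  have lower: "- p (- x) \<le> h x t" if "0 \<le> t" for x t
    using sublinear_add[OF p, of "x + t *\<^sub>R a" "- x"] sublinear_scale[OF p that, of a]
    by (simp add: h_def)
  have q_le: "q x \<le> h x t" if "0 \<le> t" for x t
    unfolding q_def using that lower by (intro cINF_lower bdd_belowI2[of _ "- p (- x)"]) auto
  have le_q: "b \<le> q x" if "\<And>t. 0 \<le> t \<Longrightarrow> b \<le> h x t" for x b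
    unfolding q_def using that by (intro cINF_greatest) auto
  have h_add: "h (x + y) (s + t) \<le> h x s + h y t" for x y s t
    using sublinear_add[OF p, of "x + s *\<^sub>R a" "y + t *\<^sub>R a"]
    by (simp add: h_def algebra_simps)
  have add: "q (x + y) \<le> q x + q y" for x y
  proof -
    \<comment> \<open>The infima over \<open>s\<close> and \<open>t\<close> are taken one after the
      other: first \<open>t\<close> with \<open>s\<close> fixed, then \<open>s\<close>.\<close>
    have "q (x + y) - h x s \<le> h y t" if "0 \<le> s" "0 \<le> t" for s t
      using q_le[of "s + t" "x + y"] h_add[of x y s t] that by simp
    then have "q (x + y) - h x s \<le> q y" if "0 \<le> s" for s
      using that by (intro le_q) auto
    then have "q (x + y) - q y \<le> h x s" if "0 \<le> s" for s
      using that by (simp add: algebra_simps)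
    then show ?thesis using le_q[of "q (x + y) - q y" x] by simp
  qed
  have scale: "q (c *\<^sub>R x) \<le> c * q x" if c: "0 < c" for c x
  proof -
    have "q (c *\<^sub>R x) / c \<le> h x t" if t: "0 \<le> t" for t
    proof -
      have "h (c *\<^sub>R x) (c * t) = c * h x t"
        using sublinear_scale[OF p, of c "x + t *\<^sub>R a"] c
        by (simp add: h_def algebra_simps)
      then show ?thesis
        using q_le[of "c * t" "c *\<^sub>R x"] c t by (simp add: field_simps)
    qed
    then have "q (c *\<^sub>R x) / c \<le> q x" by (rule le_q)
    then show ?thesis using c by (simp add: field_simps)
  qed
  have h0: "h 0 t = 0" if "0 \<le> t" for t
    using sublinear_scale[OF p that, of a] by (simp add: h_def)
  have "q 0 = 0"
  proof (rule antisym)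
    show "q 0 \<le> 0" using q_le[of 0 0] by (simp add: h0)
    show "0 \<le> q 0" by (rule le_q) (simp add: h0)
  qed
  with add scale have "sublinear q" by (rule sublinearI)
  moreover have "q \<le> p"
    using q_le[of 0] by (simp add: le_fun_def h_def)
  moreover have "q (- a) \<le> - p a"
    using q_le[of 1 "- a"] sublinear_zero[OF p] by (simp add: h_def)
  ultimately show ?thesis by blast
qed

text \<open>Zorn's lemma for the reversed pointwise order: \<open>P f g\<close> means
  \<open>g \<le> f\<close>, so an upper bound of a nonempty chain is its pointwise infimum.\<close>

lemma exists_minimal_sublinear:
  fixes p :: "'a::real_vector \<Rightarrow> real"
  assumes p: "sublinear p"
  shows "\<exists>f. sublinear f \<and> f \<le> p \<and> (\<forall>q. sublinear q \<longrightarrow> q \<le> f \<longrightarrow> q = f)"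
proof -
  define A where "A = {q. sublinear q \<and> q \<le> p}"
  define P :: "('a \<Rightarrow> real) \<Rightarrow> ('a \<Rightarrow> real) \<Rightarrow> bool" where "P f g \<longleftrightarrow> g \<le> f" for f g
  have po: "partial_order_on A (relation_of P A)"
    by (rule partial_order_on_relation_ofI) (auto simp: P_def)
  have chain: "\<exists>u\<in>A. \<forall>q\<in>C. P q u" if C: "C \<in> Chains (relation_of P A)" for C
  proof (cases "C = {}")
    case True
    then show ?thesis using p by (auto simp: A_def)
  next
    case False
    have CA: "C \<subseteq> A" using C by (rule Chains_relation_of)
    have comp: "f \<le> g \<or> g \<le> f" if "f \<in> C" "g \<in> C" for f g
      using C that by (auto simp: Chains_def relation_of_def P_def)
    have sub: "sublinear f" if "f \<in> C" for f using that CA by (auto simp: A_def)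
    define u where "u x = (INF f\<in>C. f x)" for x
    \<comment> \<open>Sublinearity gives \<open>- f (- x) \<le> f x\<close>, and
      \<open>f \<le> p\<close> makes the bound uniform over the chain.\<close>
    have lower: "- p (- x) \<le> f x" if "f \<in> C" for f x
    proof -
      have "f \<le> p" using that CA by (auto simp: A_def)
      then have "f (- x) \<le> p (- x)" by (rule le_funD)
      then show ?thesis
        using sublinear_add[OF sub[OF that], of x "- x"] sublinear_zero[OF sub[OF that]] by simp
    qed
    have u_le: "u x \<le> f x" if "f \<in> C" for f x
      unfolding u_def using that lower by (intro cINF_lower bdd_belowI2[of _ "- p (- x)"]) auto
    have le_u: "b \<le> u x" if "\<And>f. f \<in> C \<Longrightarrow> b \<le> f x" for x b
      unfolding u_def using that False by (intro cINF_greatest) auto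
    have add: "u (x + y) \<le> u x + u y" for x y
    proof -
      \<comment> \<open>Nearly optimal members for \<open>x\<close> and for \<open>y\<close> may
        differ; in a chain the smaller one serves both points.\<close>
      have "u (x + y) - f x \<le> g y" if fg: "f \<in> C" "g \<in> C" for f g
      proof -
        obtain k where k: "k \<in> C" "k \<le> f" "k \<le> g"
          using comp[OF fg] fg by blast
        have "u (x + y) \<le> k x + k y"
          using u_le[OF k(1), of "x + y"] sublinear_add[OF sub[OF k(1)], of x y] by simp
        then show ?thesis using le_funD[OF k(2), of x] le_funD[OF k(3), of y] by simp
      qed
      then have "u (x + y) - f x \<le> u y" if "f \<in> C" for f
        using that by (intro le_u) auto
      then have "u (x + y) - u y \<le> f x" if "f \<in> C" for f
        using that by (simp add: algebra_simps)
      then show ?thesis using le_u[of "u (x + y) - u y" x] by simp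
    qed
    have scale: "u (c *\<^sub>R x) \<le> c * u x" if c: "0 < c" for c x
    proof -
      have "u (c *\<^sub>R x) / c \<le> f x" if "f \<in> C" for f
        using u_le[OF that, of "c *\<^sub>R x"] sublinear_scale[OF sub[OF that], of c x] c
        by (simp add: field_simps)
      then have "u (c *\<^sub>R x) / c \<le> u x" by (rule le_u)
      then show ?thesis using c by (simp add: field_simps)
    qed
    obtain f0 where f0: "f0 \<in> C" using False by blast
    have "u 0 = 0"
    proof (rule antisym)
      show "u 0 \<le> 0" using u_le[OF f0, of 0] sublinear_zero[OF sub[OF f0]] by simp
      show "0 \<le> u 0" by (rule le_u) (simp add: sublinear_zero[OF sub])
    qed
    with add scale have "sublinear u" by (rule sublinearI)
    moreover have u_C: "u \<le> f" if "f \<in> C" for f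
      using u_le[OF that] by (rule le_funI)
    moreover have "f0 \<le> p" using f0 CA unfolding A_def by blast
    then have "u \<le> p" using u_C[OF f0] by (rule order_trans[rotated])
    ultimately have "u \<in> A" "\<forall>f\<in>C. P f u" by (simp_all add: A_def P_def)
    then show ?thesis by blast
  qed
  obtain m where "m \<in> A" "\<forall>q\<in>A. P m q \<longrightarrow> q = m"
    using predicate_Zorn[OF po chain] by blast
  then have "sublinear m" "m \<le> p" and min: "\<And>q. sublinear q \<Longrightarrow> q \<le> p \<Longrightarrow> q \<le> m \<Longrightarrow> q = m"
    by (simp_all add: A_def P_def)
  then show ?thesis using order_trans[OF _ \<open>m \<le> p\<close>] by blast
qed

text \<open>Tilting twice: once at a to force attainment of p a, and once at every point
  to see that a minimal sublinear functional is odd, hence linear.\<close>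
lemma hahn_banach_sublinear:
  fixes p :: "'a::real_vector \<Rightarrow> real"
  assumes p: "sublinear p"
  shows "\<exists>f. linear f \<and> (\<forall>x. f x \<le> p x) \<and> f a = p a"
proof -
  obtain q where q: "sublinear q" "q \<le> p" "q (- a) \<le> - p a"
    using sublinear_tilt[OF p] by blast
  obtain f where f: "sublinear f" "f \<le> q" "\<And>g. sublinear g \<Longrightarrow> g \<le> f \<Longrightarrow> g = f"
    using exists_minimal_sublinear[OF q(1)] by blast
  have odd: "f (- x) = - f x" for x
  proof -
    obtain g where g: "sublinear g" "g \<le> f" "g (- x) \<le> - f x"
      using sublinear_tilt[OF f(1)] by blast
    then have "f (- x) \<le> - f x" using f(3)[OF g(1,2)] by simp
    moreover have "0 \<le> f x + f (- x)"
      using sublinear_add[OF f(1), of x "- x"] sublinear_zero[OF f(1)] by simp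
    ultimately show ?thesis by simp
  qed
  have "linear f"
  proof (rule linearI)
    fix x y
    have "f (- x + - y) \<le> f (- x) + f (- y)" by (rule sublinear_add[OF f(1)])
    then have "f x + f y \<le> f (x + y)" using odd[of "x + y"] by (simp add: odd)
    then show "f (x + y) = f x + f y" using sublinear_add[OF f(1), of x y] by simp
  next
    fix c x
    show "f (c *\<^sub>R x) = c *\<^sub>R f x"
    proof (cases "0 \<le> c")
      case False
      then have "f ((- c) *\<^sub>R x) = - c * f x" by (intro sublinear_scale[OF f(1)]) simp
      then show ?thesis using odd[of "c *\<^sub>R x"] by simp
    qed (simp add: sublinear_scale[OF f(1)])
  qed
  moreover have "f x \<le> p x" for x
    using f(2) q(2) by (meson le_funD order_trans)
  moreover have "f a = p a"
  proof (rule antisym)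
    have "f (- a) \<le> - p a" using f(2) q(3) by (meson le_funD order_trans)
    then show "p a \<le> f a" using odd by simp
  qed fact
  ultimately show ?thesis by blast
qed

text \<open>Dominate by the norm of the positive part rather than by the norm: this majorant
  vanishes at \<open>- x\<close> for \<open>0 \<le> x\<close>, which forces positivity, and still
  equals \<open>norm a\<close> at \<open>a\<close>.\<close>

lemma norming_positive_functional:
  fixes a :: "'a::banach_lattice"
  assumes "0 \<le> a"
  shows "\<exists>f::'a \<Rightarrow> real. linear f \<and> (\<forall>x. \<bar>f x\<bar> \<le> norm x) \<and> (\<forall>x\<ge>0. 0 \<le> f x) \<and> f a = norm a"
proof -
  have "sublinear (\<lambda>x::'a. norm (pprt x))"
  proof (rule sublinearI)
    fix x y :: 'a
    have "norm (pprt (x + y)) \<le> norm (pprt x + pprt y)"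
      by (intro norm_mono_lattice pprt_add_le) simp
    then show "norm (pprt (x + y)) \<le> norm (pprt x) + norm (pprt y)"
      using norm_triangle_ineq[of "pprt x" "pprt y"] by simp
  next
    fix c :: real and x :: 'a assume "0 < c"
    then have "norm (pprt (c *\<^sub>R x)) \<le> norm (c *\<^sub>R pprt x)"
      by (intro norm_mono_lattice pprt_scaleR_le) simp_all
    then show "norm (pprt (c *\<^sub>R x)) \<le> c * norm (pprt x)"
      using \<open>0 < c\<close> by simp
  qed simp
  then obtain f where f: "linear f" "\<And>x. f x \<le> norm (pprt x)" "f a = norm (pprt a)"
    using hahn_banach_sublinear[of _ a] by blast
  have minus: "f (- x) = - f x" for x using f(1) by (rule linear_neg)
  have "\<bar>f x\<bar> \<le> norm x" for x
    using f(2)[of x] f(2)[of "- x"] norm_pprt_le[of x] norm_pprt_le[of "- x"]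
    by (simp add: minus abs_le_iff)
  moreover have "0 \<le> f x" if "0 \<le> x" for x
    using f(2)[of "- x"] that by (simp add: minus)
  moreover have "f a = norm a" using f(3) assms by simp
  ultimately show ?thesis using f(1) by blast
qed

subsection \<open>Weakly null sequences in order intervals\<close>

text \<open>\<open>f\<close> is the sum of the \<open>g n\<close> with weights
  \<open>(1/2) ^ n\<close>. On the cone all terms are nonnegative, so the sum dominates each of
  them. Thus one functional, to which weak nullity applies, controls all \<open>g n\<close>
  there.\<close>

lemma weighted_functional_sum:
  fixes g :: "nat \<Rightarrow> 'a::banach_lattice \<Rightarrow> real"
  assumes lin: "\<And>n. linear (g n)" and bdd: "\<And>n x. \<bar>g n x\<bar> \<le> norm x"
    and pos: "\<And>n x. 0 \<le> x \<Longrightarrow> 0 \<le> g n x"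
  obtains f :: "'a \<Rightarrow> real" where "bounded_linear f" "\<And>x. 0 \<le> x \<Longrightarrow> 0 \<le> f x"
    "\<And>n x. 0 \<le> x \<Longrightarrow> g n x \<le> 2 ^ n * f x"
proof -
  define f where "f x = (\<Sum>n. (1/2) ^ n * g n x)" for x
  have geo: "summable (\<lambda>n. (1/2) ^ n * norm x)" for x :: 'a
    by (intro summable_mult2 summable_geometric) simp
  have le: "norm ((1/2) ^ n * g n x) \<le> (1/2) ^ n * norm x" for n x
    by (simp add: abs_mult bdd mult_left_mono)
  have summ: "summable (\<lambda>n. (1/2) ^ n * g n x)" for x
    using geo le by (rule summable_comparison_test'[where N = 0])
  show thesis
  proof
    show "bounded_linear f"
    proof (rule bounded_linear_intro)
      fix x y
      have "(\<lambda>n. (1/2) ^ n * g n (x + y)) = (\<lambda>n. (1/2) ^ n * g n x + (1/2) ^ n * g n y)"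
        by (simp add: linear_add[OF lin] algebra_simps)
      then show "f (x + y) = f x + f y"
        unfolding f_def using suminf_add[OF summ summ, of x y] by simp
    next
      fix r x
      have "(\<lambda>n. (1/2) ^ n * g n (r *\<^sub>R x)) = (\<lambda>n. r * ((1/2) ^ n * g n x))"
        by (simp add: linear_scale[OF lin] algebra_simps)
      then show "f (r *\<^sub>R x) = r *\<^sub>R f x"
        unfolding f_def using suminf_mult[OF summ, of r x] by simp
    next
      fix x
      have "norm (f x) \<le> (\<Sum>n. (1/2) ^ n * norm x)"
        unfolding f_def using le geo by (rule norm_suminf_le)
      also have "\<dots> = norm x * 2"
        using suminf_mult2[of "\<lambda>n. (1/2::real) ^ n" "norm x"] suminf_geometric[of "1/2::real"]
          summable_geometric[of "1/2::real"] by simp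
      finally show "norm (f x) \<le> norm x * 2" .
    qed
  next
    fix x :: 'a assume x: "0 \<le> x"
    then show "0 \<le> f x"
      unfolding f_def using pos by (intro suminf_nonneg summ) simp
    fix n
    have "(1/2) ^ n * g n x \<le> f x"
      unfolding f_def using sum_le_suminf[OF summ, of "{n}" x] pos[OF x] by simp
    then show "g n x \<le> 2 ^ n * f x"
      by (simp add: field_simps)
  qed
qed

text \<open>\<open>V n\<close> plays the role of the supremum of the tail of \<open>z\<close> from
  \<open>n\<close> on. It is obtained as the norm limit of finite suprema; the geometric bound on
  \<open>f\<close> passes to \<open>V n\<close>, and then to the limit \<open>v\<close>.\<close>

lemma order_continuous_tail_sups:
  fixes z :: "nat \<Rightarrow> 'a::banach_lattice" and f :: "'a \<Rightarrow> real"
  assumes oc: "order_continuous_norm TYPE('a)"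
    and z: "\<And>n. 0 \<le> z n" "\<And>n. z n \<le> b"
    and f: "bounded_linear f" "\<And>x. 0 \<le> x \<Longrightarrow> 0 \<le> f x"
    and fz: "\<And>n. f (z n) \<le> (1/2) ^ n"
  obtains V v where "\<And>n. z n \<le> V n" "V \<longlonglongrightarrow> v" "0 \<le> v" "\<And>n. v \<le> V n" "f v \<le> 0"
proof -
  interpret f: bounded_linear f by fact
  have f_mono: "f x \<le> f y" if "x \<le> y" for x y
    using f(2)[of "y - x"] that by (simp add: f.diff)
  \<comment> \<open>\<open>s n m\<close> is the supremum of \<open>z n\<close>, ...,
    \<open>z (n + m)\<close>.\<close>
  define s where "s n = rec_nat (z n) (\<lambda>m t. sup t (z (n + Suc m)))" for n
  have s_simps: "s n 0 = z n" "s n (Suc m) = sup (s n m) (z (n + Suc m))" for n m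
    by (simp_all add: s_def)
  have s_inc: "incseq (s n)" for n
    by (rule incseq_SucI) (simp add: s_simps)
  have s_le: "s n m \<le> b" for n m
    by (induction m) (simp_all add: s_simps z)
  have s_ge: "z n \<le> s n m" for n m
    using incseqD[OF s_inc, of 0 m n] by (simp add: s_simps)
  have s_nonneg: "0 \<le> s n m" for n m
    using z(1) s_ge order_trans by blast
  \<comment> \<open>Both blocks end at index n + m + 1; the right one starts one term
    earlier.\<close>
  have s_shift: "s (Suc n) m \<le> s n (Suc m)" for n m
    by (induction m) (auto simp: s_simps intro: le_supI1)
  \<comment> \<open>The right-hand side is the geometric sum over the indices n, ..., n + m; a
    supremum of positive elements is at most their sum.\<close>
  have f_s: "f (s n m) \<le> 2 * (1/2) ^ n - (1/2) ^ (n + m)" for n m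
  proof (induction m)
    case 0
    then show ?case using fz[of n] by (simp add: s_simps)
  next
    case (Suc m)
    have "s n (Suc m) \<le> s n m + z (n + Suc m)"
      using s_nonneg[of n m] z(1)[of "n + Suc m"] by (simp add: s_simps add_increasing)
    then have "f (s n (Suc m)) \<le> f (s n m) + f (z (n + Suc m))"
      using f_mono f.add by metis
    then show ?case using Suc fz[of "n + Suc m"] by simp
  qed
  have "\<exists>l. s n \<longlonglongrightarrow> l" for n
    using incseq_convergent_order_continuous[OF oc s_inc s_le] unfolding convergent_def .
  then obtain V where V: "\<And>n. s n \<longlonglongrightarrow> V n" by metis
  have zV: "z n \<le> V n" for n
    using V s_ge by (rule le_limit)
  have "decseq V"
  proof (rule decseq_SucI)
    fix n
    have "s (Suc n) m \<le> V n" for m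
      using s_shift[of n m] incseq_le_limit[OF V s_inc, of n "Suc m"] by simp
    then show "V (Suc n) \<le> V n"
      using limit_le[OF V] by blast
  qed
  \<comment> \<open>The convergence result concerns increasing sequences, hence the sign change;
    positivity of \<open>V\<close> becomes the upper bound 0.\<close>
  then have inc: "incseq (\<lambda>n. - V n)"
    by (simp add: decseq_def incseq_def)
  have V_nonneg: "0 \<le> V n" for n
    using zV z(1) order_trans by blast
  then obtain l where l: "(\<lambda>n. - V n) \<longlonglongrightarrow> l"
    using incseq_convergent_order_continuous[OF oc inc, of 0] unfolding convergent_def by auto
  define v where "v = - l"
  have Vv: "V \<longlonglongrightarrow> v"
    using tendsto_minus[OF l] by (simp add: v_def)
  have vV: "v \<le> V n" for n
    using incseq_le_limit[OF l inc, of n] by (simp add: v_def minus_le_iff)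
  have fV: "f (V n) \<le> 2 * (1/2) ^ n" for n
  proof (rule LIMSEQ_le_const2[OF f.tendsto[OF V]], intro exI allI impI)
    fix m
    show "f (s n m) \<le> 2 * (1/2) ^ n"
      using f_s[of n m] zero_le_power[of "1/2::real" "n + m"] by linarith
  qed
  have "(\<lambda>n. 2 * (1/2::real) ^ n) \<longlonglongrightarrow> 2 * 0"
    by (intro tendsto_intros LIMSEQ_realpow_zero) simp_all
  moreover have "f v \<le> 2 * (1/2) ^ n" for n
    using f_mono[OF vV] fV by (rule order_trans)
  ultimately have "f v \<le> 2 * 0"
    by (meson LIMSEQ_le_const)
  then show thesis
    using that[OF zV Vv nonneg_limit[OF Vv V_nonneg] vV] by simp
qed

text \<open>A single positive functional f dominating norming functionals of all terms
  detects norm convergence: along a subsequence with f-values below the geometric series, the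
  tail suprema decrease to an element on which f, hence every norming functional, vanishes.\<close>
lemma order_interval_weakly_null_imp_norm_null:
  fixes y :: "nat \<Rightarrow> 'a::banach_lattice"
  assumes oc: "order_continuous_norm TYPE('a)"
    and y: "\<And>n. 0 \<le> y n" "\<And>n. y n \<le> b"
    and wn: "weakly_null y"
  shows "y \<longlonglongrightarrow> 0"
proof (rule ccontr)
  assume "\<not> y \<longlonglongrightarrow> 0"
  then obtain e where e: "0 < e" "\<And>N. \<exists>n\<ge>N. e \<le> norm (y n)"
    unfolding LIMSEQ_iff by (auto simp: not_less)
  obtain g :: "nat \<Rightarrow> 'a \<Rightarrow> real" where
    g: "\<And>n. linear (g n)" "\<And>n x. \<bar>g n x\<bar> \<le> norm x" "\<And>n x. 0 \<le> x \<Longrightarrow> 0 \<le> g n x"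
      and gy: "\<And>n. g n (y n) = norm (y n)"
    using norming_positive_functional[OF y(1)] by metis
  obtain f :: "'a \<Rightarrow> real" where f: "bounded_linear f" "\<And>x. 0 \<le> x \<Longrightarrow> 0 \<le> f x"
    and gf: "\<And>n x. 0 \<le> x \<Longrightarrow> g n x \<le> 2 ^ n * f x"
    using weighted_functional_sum[of g] g by metis
  have fy: "(\<lambda>n. f (y n)) \<longlonglongrightarrow> 0"
    using wn f(1) by (simp add: weakly_null_def)
  have "\<exists>n. e \<le> norm (y n) \<and> f (y n) \<le> (1/2) ^ k" for k :: nat
  proof -
    have "\<forall>\<^sub>F n in sequentially. f (y n) < (1/2) ^ k"
      using order_tendstoD(2)[OF fy, of "(1/2) ^ k"] by simp
    then obtain N where "\<And>n. n \<ge> N \<Longrightarrow> f (y n) < (1/2) ^ k"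
      unfolding eventually_sequentially by blast
    then show ?thesis using e(2)[of N] by (meson less_imp_le)
  qed
  then obtain r where r: "\<And>k. e \<le> norm (y (r k))" "\<And>k. f (y (r k)) \<le> (1/2) ^ k"
    by metis
  obtain V v where V: "\<And>n. y (r n) \<le> V n" "V \<longlonglongrightarrow> v" "0 \<le> v" "\<And>n. v \<le> V n" "f v \<le> 0"
    using order_continuous_tail_sups[of "\<lambda>n. y (r n)" b f, OF oc y f r(2)] by blast
  \<comment> \<open>Since \<open>g (r k)\<close> is at most 0 at \<open>v\<close>, subtracting
    \<open>v\<close> from \<open>V k\<close> does not lower its value, which is already at least the
    norm of \<open>y (r k)\<close>.\<close>
  have "e \<le> norm (V k - v)" for k
  proof -
    have "g (r k) v \<le> 2 ^ r k * f v" using gf V(3) by blast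
    also have "\<dots> \<le> 0" using V(5) by (simp add: mult_nonneg_nonpos)
    finally have gv: "g (r k) v \<le> 0" .
    have "0 \<le> g (r k) (V k - y (r k))" using V(1) by (intro g(3)) simp
    then have "norm (y (r k)) \<le> g (r k) (V k)" using gy[of "r k"] by (simp add: linear_diff[OF g(1)])
    also have "\<dots> \<le> g (r k) (V k - v)" using gv by (simp add: linear_diff[OF g(1)])
    also have "\<dots> \<le> norm (V k - v)" using g(2)[of "r k" "V k - v"] by simp
    finally show ?thesis using r(1)[of k] by simp
  qed
  moreover have "(\<lambda>k. norm (V k - v)) \<longlonglongrightarrow> 0"
    using V(2) by (simp add: LIM_zero tendsto_norm_zero)
  ultimately have "e \<le> 0" by (meson LIMSEQ_le_const)
  then show False using e(1) by simp
qed

subsection \<open>Disjointification\<close>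

text \<open>The two elements lie below the positive parts of
  \<open>4 ^ n *\<^sub>R y m - y n\<close> and of its negative, and these are disjoint.\<close>

lemma disjoint_pprt_diff:
  fixes y :: "nat \<Rightarrow> 'a::banach_lattice"
  assumes y: "\<And>n. 0 \<le> y n" and z: "\<And>n. (1/2) ^ n *\<^sub>R y n \<le> z"
    and mn: "m < n"
  shows "inf (pprt (y m - 4 ^ m *\<^sub>R (\<Sum>i<m. y i) - (1/2) ^ m *\<^sub>R z))
             (pprt (y n - 4 ^ n *\<^sub>R (\<Sum>i<n. y i) - (1/2) ^ n *\<^sub>R z)) = 0" (is "inf ?wm ?wn = 0")
proof -
  have z0: "0 \<le> z" using z[of 0] y[of 0] by simp
  have "?wn \<le> pprt (- (4 ^ n *\<^sub>R y m - y n))"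
  proof (rule pprt_mono)
    \<comment> \<open>Because m < n, \<open>y m\<close> is one of the summands subtracted at stage
      \<open>n\<close>.\<close>
    have "y m \<le> (\<Sum>i<n. y i)"
      using sum_mono2[of "{..<n}" "{m}" y] mn y by simp
    then have "4 ^ n *\<^sub>R y m \<le> 4 ^ n *\<^sub>R (\<Sum>i<n. y i)"
      by (intro scaleR_left_mono) simp_all
    moreover have "0 \<le> (1/2) ^ n *\<^sub>R z" using z0 by (simp add: scaleR_nonneg_nonneg)
    ultimately have "y n - 4 ^ n *\<^sub>R (\<Sum>i<n. y i) - (1/2) ^ n *\<^sub>R z \<le> y n - 4 ^ n *\<^sub>R y m - 0"
      by (intro diff_mono) simp_all
    then show "y n - 4 ^ n *\<^sub>R (\<Sum>i<n. y i) - (1/2) ^ n *\<^sub>R z \<le> - (4 ^ n *\<^sub>R y m - y n)"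
      by simp
  qed
  moreover have "?wm \<le> pprt (4 ^ n *\<^sub>R y m - y n)"
  proof -
    \<comment> \<open>This is where the correction by \<open>z\<close> pays off: half of the factor
      \<open>4 ^ n\<close> is spent on y n <= 2^n z, the other half on reaching the coefficient at
      stage \<open>m\<close>.\<close>
    have "(1/4) ^ n *\<^sub>R y n \<le> (1/2) ^ m *\<^sub>R z"
    proof -
      have "(1/4::real) ^ n = (1/2) ^ n * (1/2) ^ n"
        by (simp flip: power_mult_distrib)
      then have "(1/4) ^ n *\<^sub>R y n = (1/2) ^ n *\<^sub>R ((1/2) ^ n *\<^sub>R y n)"
        by simp
      also have "\<dots> \<le> (1/2) ^ n *\<^sub>R z"
        using z by (intro scaleR_left_mono) simp_all
      also have "\<dots> \<le> (1/2) ^ m *\<^sub>R z"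
        using z0 mn by (intro scaleR_right_mono power_decreasing) simp_all
      finally show ?thesis .
    qed
    moreover have "0 \<le> 4 ^ m *\<^sub>R (\<Sum>i<m. y i)"
      using y by (intro scaleR_nonneg_nonneg sum_nonneg) simp_all
    ultimately have "y m - 4 ^ m *\<^sub>R (\<Sum>i<m. y i) - (1/2) ^ m *\<^sub>R z \<le> y m - 0 - (1/4) ^ n *\<^sub>R y n"
      by (intro diff_mono) simp_all
    also have "\<dots> = (1/4) ^ n *\<^sub>R (4 ^ n *\<^sub>R y m - y n)"
      by (simp add: scaleR_right_diff_distrib flip: power_mult_distrib)
    also have "\<dots> \<le> (1/4) ^ n *\<^sub>R pprt (4 ^ n *\<^sub>R y m - y n)"
      by (intro scaleR_left_mono le_pprt) simp
    also have "\<dots> \<le> 1 *\<^sub>R pprt (4 ^ n *\<^sub>R y m - y n)"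
      by (intro scaleR_right_mono power_le_one) simp_all
    finally show ?thesis by (simp add: pprt_le_iff)
  qed
  ultimately have "inf ?wm ?wn \<le> 0"
    using inf_mono inf_pprt_pprt_minus by metis
  then show ?thesis by (intro antisym) simp_all
qed

text \<open>Otherwise one chooses recursively members of A far from multiples of the sum of
  their predecessors, and disjointifies them.\<close>
lemma approximately_order_bounded:
  fixes A :: "'a::banach_lattice set"
  assumes bdd: "bounded A" and e: "0 < e"
    and disj: "\<And>w. disjoint_seq w \<Longrightarrow> (\<And>n. w n \<in> solid_hull A) \<Longrightarrow> w \<longlonglongrightarrow> 0"
  shows "\<exists>u\<ge>0. \<forall>a\<in>A. norm (pprt (lmod a - u)) \<le> e"
proof (rule ccontr)
  assume "\<not> ?thesis"
  \<comment> \<open>Keeping the sign condition under the quantifier lets \<open>h\<close> be a total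
    choice function.\<close>
  then have "\<exists>a. 0 \<le> u \<longrightarrow> a \<in> A \<and> e < norm (pprt (lmod a - u))" for u
    by (metis not_le)
  then obtain h where h: "\<And>u. 0 \<le> u \<Longrightarrow> h u \<in> A"
    "\<And>u. 0 \<le> u \<Longrightarrow> e < norm (pprt (lmod (h u) - u))" by metis
  \<comment> \<open>\<open>S n\<close> is the running sum of the moduli chosen so far; the next
    choice is made against \<open>4 ^ n *\<^sub>R S n\<close>, as the disjointification
    requires.\<close>
  define S where "S = rec_nat 0 (\<lambda>n s. s + lmod (h (4 ^ n *\<^sub>R s)))"
  define y where "y n = lmod (h (4 ^ n *\<^sub>R S n))" for n
  have S_sum: "S n = (\<Sum>i<n. y i)" for n
  proof (induction n)
    case 0
    show ?case by (simp add: S_def)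
  next
    case (Suc n)
    have "S (Suc n) = S n + y n" by (simp add: S_def y_def)
    then show ?case using Suc by simp
  qed
  have y0: "0 \<le> y n" for n by (simp add: y_def)
  have S0: "0 \<le> 4 ^ n *\<^sub>R S n" for n
    by (simp add: S_sum y0 sum_nonneg scaleR_nonneg_nonneg)
  have big: "e < norm (pprt (y n - 4 ^ n *\<^sub>R S n))" for n
    unfolding y_def using h(2) S0 by blast
  obtain M where M: "\<And>a. a \<in> A \<Longrightarrow> norm a \<le> M"
    using bdd unfolding bounded_iff by blast
  have yM: "norm (y n) \<le> M" for n
    unfolding y_def using M h(1) S0 by simp
  have summ: "summable (\<lambda>n. (1/2) ^ n *\<^sub>R y n)"
  proof (rule summable_comparison_test')
    show "summable (\<lambda>n. (1/2::real) ^ n * M)"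
      by (intro summable_mult2 summable_geometric) simp
    show "norm ((1/2) ^ n *\<^sub>R y n) \<le> (1/2) ^ n * M" for n
      using yM by (simp add: mult_left_mono)
  qed
  \<comment> \<open>One element dominating every \<open>(1/2) ^ n *\<^sub>R y n\<close>; the series
    converges because \<open>A\<close> is bounded.\<close>
  define z where "z = (\<Sum>n. (1/2) ^ n *\<^sub>R y n)"
  have z: "(1/2) ^ n *\<^sub>R y n \<le> z" for n
  proof -
    have "incseq (\<lambda>k. \<Sum>i<k. (1/2) ^ i *\<^sub>R y i)"
      by (intro incseq_SucI) (simp add: y0 scaleR_nonneg_nonneg)
    then have "(\<Sum>i<Suc n. (1/2) ^ i *\<^sub>R y i) \<le> z"
      using summable_LIMSEQ[OF summ] incseq_le_limit unfolding z_def by blast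
    moreover have "(1/2) ^ n *\<^sub>R y n \<le> (\<Sum>i<Suc n. (1/2) ^ i *\<^sub>R y i)"
      by (simp add: y0 sum_nonneg scaleR_nonneg_nonneg)
    ultimately show ?thesis by (rule order_trans[rotated])
  qed
  have z0: "0 \<le> z" using z[of 0] y0[of 0] by simp
  define w where "w n = pprt (y n - 4 ^ n *\<^sub>R S n - (1/2) ^ n *\<^sub>R z)" for n
  have w_disj: "inf (w m) (w n) = 0" if "m < n" for m n
    unfolding w_def S_sum using y0 z that by (rule disjoint_pprt_diff)
  have lmod_w: "lmod (w n) = w n" for n
    by (simp add: w_def lmod_of_nonneg)
  have "disjoint_seq w"
    unfolding disjoint_seq_def lmod_w using w_disj by (metis inf_commute nat_neq_iff)
  moreover have "w n \<in> solid_hull A" for n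
  proof -
    have "y n - 4 ^ n *\<^sub>R S n - (1/2) ^ n *\<^sub>R z \<le> y n - 0 - 0"
      by (intro diff_mono S0 scaleR_nonneg_nonneg[OF _ z0]) simp_all
    then have "w n \<le> y n" using y0 by (simp add: w_def pprt_le_iff)
    then have "lmod (w n) \<le> lmod (h (4 ^ n *\<^sub>R S n))" by (simp only: lmod_w y_def)
    then show ?thesis using h(1) S0 unfolding solid_hull_def by blast
  qed
  ultimately have "w \<longlonglongrightarrow> 0" by (rule disj)
  then have "(\<lambda>n. norm (w n) + (1/2) ^ n * norm z) \<longlonglongrightarrow> 0 + 0 * norm z"
    by (intro tendsto_intros tendsto_norm_zero LIMSEQ_realpow_zero) simp_all
  \<comment> \<open>Passing to \<open>w n\<close> costs at most
    \<open>(1/2) ^ n *\<^sub>R z\<close>, which vanishes in the limit, so the \<open>w n\<close>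
    cannot be norm null.\<close>
  moreover have "e \<le> norm (w n) + (1/2) ^ n * norm z" for n
  proof -
    have "pprt ((y n - 4 ^ n *\<^sub>R S n - (1/2) ^ n *\<^sub>R z) + (1/2) ^ n *\<^sub>R z) \<le> w n + pprt ((1/2) ^ n *\<^sub>R z)"
      unfolding w_def by (rule pprt_add_le)
    then have "pprt (y n - 4 ^ n *\<^sub>R S n) \<le> w n + (1/2) ^ n *\<^sub>R z"
      using z0 by (simp add: scaleR_nonneg_nonneg)
    then have "norm (pprt (y n - 4 ^ n *\<^sub>R S n)) \<le> norm (w n + (1/2) ^ n *\<^sub>R z)"
      by (intro norm_mono_lattice) simp_all
    also have "\<dots> \<le> norm (w n) + (1/2) ^ n * norm z"
      using norm_triangle_ineq[of "w n" "(1/2) ^ n *\<^sub>R z"] by simp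
    finally show ?thesis using big[of n] by simp
  qed
  ultimately have "e \<le> 0 + 0 * norm z" by (meson LIMSEQ_le_const)
  then show False using e by simp
qed

text \<open>The hypothesis concerns the unit ball; its approximation with tolerance
  \<open>e / M\<close> is scaled by \<open>M\<close>.\<close>

lemma L_weakly_compact_approx:
  fixes T :: "'e::banach_lattice \<Rightarrow> 'f::banach_lattice"
  assumes T: "L_weakly_compact T" and "0 < e" "0 < M"
  shows "\<exists>u\<ge>0. \<forall>x. norm x \<le> M \<longrightarrow> norm (pprt (lmod (T x) - u)) \<le> e"
proof -
  interpret T: bounded_linear T using T by (simp add: L_weakly_compact_def)
  have "bounded (T ` cball 0 1)"
    using T.bounded_linear_axioms by (intro bounded_linear_image) simp_all
  moreover have "w \<longlonglongrightarrow> 0" if "disjoint_seq w" "\<And>n. w n \<in> solid_hull (T ` cball 0 1)" for w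
    using T that by (simp add: L_weakly_compact_def)
  ultimately obtain u where u: "0 \<le> u" "\<And>x. norm x \<le> 1 \<Longrightarrow> norm (pprt (lmod (T x) - u)) \<le> e / M"
    using approximately_order_bounded[of "T ` cball 0 1" "e / M"] assms by auto
  have "norm (pprt (lmod (T x) - M *\<^sub>R u)) \<le> e" if x: "norm x \<le> M" for x
  proof -
    define x' where "x' = inverse M *\<^sub>R x"
    have x': "x = M *\<^sub>R x'" "norm x' \<le> 1"
      using \<open>0 < M\<close> x by (simp_all add: x'_def field_simps)
    have "lmod (T x) \<le> M *\<^sub>R lmod (T x')"
      using \<open>0 < M\<close> by (simp add: x'(1) T.scaleR lmod_scaleR_le)
    then have "pprt (lmod (T x) - M *\<^sub>R u) \<le> pprt (M *\<^sub>R (lmod (T x') - u))"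
      by (intro pprt_mono) (simp add: scaleR_right_diff_distrib)
    also have "\<dots> \<le> M *\<^sub>R pprt (lmod (T x') - u)"
      using \<open>0 < M\<close> by (intro pprt_scaleR_le) simp
    finally have "norm (pprt (lmod (T x) - M *\<^sub>R u)) \<le> M * norm (pprt (lmod (T x') - u))"
      using norm_mono_lattice[of "pprt (lmod (T x) - M *\<^sub>R u)"] \<open>0 < M\<close> by fastforce
    also have "\<dots> \<le> M * (e / M)"
      using u(2)[OF x'(2)] \<open>0 < M\<close> by (intro mult_left_mono) simp_all
    finally show ?thesis using \<open>0 < M\<close> by simp
  qed
  moreover have "0 \<le> M *\<^sub>R u" using u(1) \<open>0 < M\<close> by (simp add: scaleR_nonneg_nonneg)
  ultimately show ?thesis by blast
qed

theorem theorem2p19: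
  fixes T :: "'e::banach_lattice \<Rightarrow> 'f::banach_lattice"
  assumes "order_continuous_norm TYPE('f)"
    and "bounded_linear T"
    and "L_weakly_compact T"
    and "uaw_continuous T"
  shows "uaw_dunford_pettis T"
proof -
  have "(\<lambda>n. norm (T (x n))) \<longlonglongrightarrow> 0" if x: "norm_bounded_seq x" "uaw_null x" for x
  proof (rule LIMSEQ_I)
    fix e :: real assume e: "0 < e"
    obtain M0 where "\<And>n. norm (x n) \<le> M0" using x(1) unfolding norm_bounded_seq_def by blast
    \<comment> \<open>The maximum with 1 makes the radius of the ball positive.\<close>
    then have M: "norm (x n) \<le> max M0 1" for n by (simp add: le_max_iff_disj)
    obtain u where u: "0 \<le> u" "\<And>n. norm (pprt (lmod (T (x n)) - u)) \<le> e / 2"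
    proof -
      have "0 < e / 2" "0 < max M0 1" using e by simp_all
      then show thesis
        using L_weakly_compact_approx[OF assms(3)] M that by meson
    qed
    have "weakly_null (\<lambda>n. inf (lmod (T (x n))) u)"
      using assms(4) x u(1) unfolding uaw_continuous_def uaw_null_def by blast
    then have "(\<lambda>n. inf (lmod (T (x n))) u) \<longlonglongrightarrow> 0"
      using u(1) by (intro order_interval_weakly_null_imp_norm_null[OF assms(1), of _ u]) simp_all
    then obtain N where N: "\<And>n. n \<ge> N \<Longrightarrow> norm (inf (lmod (T (x n))) u) < e / 2"
      using LIMSEQ_D[of _ 0 "e / 2"] e by fastforce
    have "norm (T (x n)) < e" if n: "n \<ge> N" for n
    proof -
      let ?y = "lmod (T (x n))"
      have "pprt (?y - u) = ?y - inf ?y u"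
        by (simp add: pprt_def add_sup_distrib_left sup_commute)
      then have "norm ?y \<le> norm (pprt (?y - u)) + norm (inf ?y u)"
        using norm_triangle_ineq[of "pprt (?y - u)" "inf ?y u"] by (simp del: diff_inf_eq_sup)
      then show ?thesis using u(2)[of n] N[OF n] by simp
    qed
    then show "\<exists>N. \<forall>n\<ge>N. norm (norm (T (x n)) - 0) < e" by auto
  qed
  then show ?thesis using assms(2) unfolding uaw_dunford_pettis_def by blast
qed

end
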